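(* Let $\mathbb X$ be a weakly globular double category with a horizontal arrow $f:A\to B$. Then the arrow $f:\bar A\to\bar B$ in the fundamental bicategory $\mathbf{Bic}(\mathbb X)$ is an equivalence if and only if $f$ is a pre-companion in $\mathbb X$.
   Context: A double category $\mathbb X$ is an internal category in $\mathsf{Cat}$: categories $\mathbb X_0$ (objects and vertical arrows) and $\mathbb X_1$ (horizontal arrows as objects, double cells as arrows; vertical composition is written $\cdot$), functors $d_0,d_1:\mathbb X_1\to\mathbb X_0$ (horizontal domain, codomain), $s$ (horizontal identities) and $m$ (horizontal composition, written $\circ$). Write $\mathrm{Id}_A=s(A)$, $\mathrm{id}_v=s(v)$, $1_A$ for vertical identity arrows, $1_f$ for vertical identity cells. $\mathbb X$ is weakly globular if the quotient functor $\gamma:\mathbb X_0\to\mathbb X_0^d$ onto the discrete category of path components of $\mathbb X_0$ is an equivalence and induces equivalences $\mathbb X_1\times_{\mathbb X_0}\overset{n}{\cdots}\times_{\mathbb X_0}\mathbb X_1\simeq\mathbb X_1\times_{\mathbb X_0^d}\overset{n}{\cdots}\times_{\mathbb X_0^d}\mathbb X_1$ for all $n\ge 2$. A horizontal arrow $f:A\to B$ and a vertical arrow $v$ from $A$ to $B$ are companions if there are double cells $\psi$ (top $\mathrm{Id}_A$, left $1_A$, right $v$, bottom $f$) and $\chi$ (top $f$, left $v$, right $1_B$, bottom $\mathrm{Id}_B$) with $\chi\circ\psi=1_f$ and $\chi\cdot\psi=\mathrm{id}_v$; a horizontal arrow "is a companion" if it has a vertical companion. A horizontal arrow $f:A\to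 B$ in a weakly globular double category is a left pre-companion if there are horizontal arrows $f':A'\to B'$ and $r_f:B'\to C$ and a vertically invertible double cell with top $f$ and bottom $f'$, such that $r_f\circ f'$ is a companion; a right pre-companion if there are horizontal arrows $f'':A''\to B''$ and $l_f:D\to A''$ and a vertically invertible double cell with top $f$ and bottom $f''$, such that $f''\circ l_f$ is a companion; and a pre-companion if it is both. The fundamental bicategory $\mathbf{Bic}(\mathbb X)$: objects are the path components $\bar A$ of $\mathbb X_0$; 1-cells $\bar A\to\bar B$ are the horizontal arrows $A'\to B'$ of $\mathbb X$ with $\bar A'=\bar A$, $\bar B'=\bar B$; 2-cells $f\Rightarrow g$ are the double cells with top $f$ and bottom $g$, i.e. arrows of $\mathbb X_1$, with vertical composition that of $\mathbb X_1$. Horizontal composition is $m\circ\mu_2$ for a chosen pseudo-inverse $\mu_2$ of $\mathbb X_1\times_{\mathbb X_0}\mathbb X_1\to\mathbb X_1\times_{\mathbb X_0^d}\mathbb X_1$, so the composite of $f:A_1\to B_1$ and $g:B_2\to C_2$ with $\bar B_1=\bar B_2$ is $g_3\circ f_3$ for a chosen horizontally composable pair $(f_3,g_3)$ with vertically invertible double cells $f_3\to f$ and $g_3\to g$. The identity on $\bar A$ is $\mathrm{Id}_{\theta(\bar A)}$ for a chosen object $\theta(\bar A)$ in the component $\bar A$. Associativity and unit isomorphisms are the canonical ones induced by the equivalences above. *)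

theory Defs
  imports Main
begin

section \<open>Categories, functors and equivalences\<close>

text \<open>Small categories. \<open>Comp C g f\<close> is the composite "first \<open>f\<close>, then \<open>g\<close>"; it is
  only meaningful when \<open>Cod C f = Dom C g\<close>.\<close>

record ('o, 'a) category =
  Obj :: "'o set"
  Arr :: "'a set"
  Dom :: "'a \<Rightarrow> 'o"
  Cod :: "'a \<Rightarrow> 'o"
  Ident :: "'o \<Rightarrow> 'a"
  Comp :: "'a \<Rightarrow> 'a \<Rightarrow> 'a"

definition is_category :: "('o, 'a) category \<Rightarrow> bool" where
  "is_category C \<longleftrightarrow>
    (\<forall>f\<in>Arr C. Dom C f \<in> Obj C \<and> Cod C f \<in> Obj C) \<and>
    (\<forall>x\<in>Obj C. Ident C x \<in> Arr C \<and> Dom C (Ident C x) = x \<and> Cod C (Ident C x) = x) \<and>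
    (\<forall>f\<in>Arr C. \<forall>g\<in>Arr C. Cod C f = Dom C g \<longrightarrow>
       Comp C g f \<in> Arr C \<and> Dom C (Comp C g f) = Dom C f \<and> Cod C (Comp C g f) = Cod C g) \<and>
    (\<forall>f\<in>Arr C. Comp C f (Ident C (Dom C f)) = f \<and> Comp C (Ident C (Cod C f)) f = f) \<and>
    (\<forall>f\<in>Arr C. \<forall>g\<in>Arr C. \<forall>h\<in>Arr C. Cod C f = Dom C g \<longrightarrow> Cod C g = Dom C h \<longrightarrow>
       Comp C h (Comp C g f) = Comp C (Comp C h g) f)"

definition inverse_arrows :: "('o, 'a) category \<Rightarrow> 'a \<Rightarrow> 'a \<Rightarrow> bool" where
  "inverse_arrows C f g \<longleftrightarrow> f \<in> Arr C \<and> g \<in> Arr C \<and> Dom C g = Cod C f \<and> Cod C g = Dom C f \<and>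
     Comp C g f = Ident C (Dom C f) \<and> Comp C f g = Ident C (Cod C f)"

definition invertible :: "('o, 'a) category \<Rightarrow> 'a \<Rightarrow> bool" where
  "invertible C f \<longleftrightarrow> (\<exists>g. inverse_arrows C f g)"

definition inverse_arrow :: "('o, 'a) category \<Rightarrow> 'a \<Rightarrow> 'a" where
  "inverse_arrow C f = (THE g. inverse_arrows C f g)"

definition isomorphic_objects :: "('o, 'a) category \<Rightarrow> 'o \<Rightarrow> 'o \<Rightarrow> bool" where
  "isomorphic_objects C x y \<longleftrightarrow> (\<exists>f. invertible C f \<and> Dom C f = x \<and> Cod C f = y)"

record ('o, 'a, 'p, 'b) cfunctor =
  FObj :: "'o \<Rightarrow> 'p"
  FArr :: "'a \<Rightarrow> 'b"

definition is_functor ::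
  "('o, 'a) category \<Rightarrow> ('p, 'b) category \<Rightarrow> ('o, 'a, 'p, 'b) cfunctor \<Rightarrow> bool" where
  "is_functor C D F \<longleftrightarrow>
    (\<forall>x\<in>Obj C. FObj F x \<in> Obj D \<and> FArr F (Ident C x) = Ident D (FObj F x)) \<and>
    (\<forall>f\<in>Arr C. FArr F f \<in> Arr D \<and> Dom D (FArr F f) = FObj F (Dom C f) \<and>
       Cod D (FArr F f) = FObj F (Cod C f)) \<and>
    (\<forall>f\<in>Arr C. \<forall>g\<in>Arr C. Cod C f = Dom C g \<longrightarrow>
       FArr F (Comp C g f) = Comp D (FArr F g) (FArr F f))"

definition id_functor :: "('o, 'a, 'o, 'a) cfunctor" where
  "id_functor = \<lparr>FObj = (\<lambda>x. x), FArr = (\<lambda>f. f)\<rparr>"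

definition comp_functor ::
  "('p, 'b, 'q, 'c) cfunctor \<Rightarrow> ('o, 'a, 'p, 'b) cfunctor \<Rightarrow> ('o, 'a, 'q, 'c) cfunctor" where
  "comp_functor G F = \<lparr>FObj = FObj G \<circ> FObj F, FArr = FArr G \<circ> FArr F\<rparr>"

definition natural_iso ::
  "('o, 'a) category \<Rightarrow> ('p, 'b) category \<Rightarrow> ('o, 'a, 'p, 'b) cfunctor \<Rightarrow>
   ('o, 'a, 'p, 'b) cfunctor \<Rightarrow> ('o \<Rightarrow> 'b) \<Rightarrow> bool" where
  "natural_iso C D F G \<tau> \<longleftrightarrow>
    (\<forall>x\<in>Obj C. invertible D (\<tau> x) \<and> Dom D (\<tau> x) = FObj F x \<and> Cod D (\<tau> x) = FObj G x) \<and>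
    (\<forall>f\<in>Arr C. Comp D (\<tau> (Cod C f)) (FArr F f) = Comp D (FArr G f) (\<tau> (Dom C f)))"

definition pseudo_inverse ::
  "('o, 'a) category \<Rightarrow> ('p, 'b) category \<Rightarrow> ('o, 'a, 'p, 'b) cfunctor \<Rightarrow>
   ('p, 'b, 'o, 'a) cfunctor \<Rightarrow> ('p \<Rightarrow> 'b) \<Rightarrow> bool" where
  "pseudo_inverse C D F G \<epsilon> \<longleftrightarrow> is_functor C D F \<and> is_functor D C G \<and>
     natural_iso D D (comp_functor F G) id_functor \<epsilon> \<and>
     (\<exists>\<eta>. natural_iso C C id_functor (comp_functor G F) \<eta>)"

definition is_equivalence ::
  "('o, 'a) category \<Rightarrow> ('p, 'b) category \<Rightarrow> ('o, 'a, 'p, 'b) cfunctor \<Rightarrow> bool" where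
  "is_equivalence C D F \<longleftrightarrow> (\<exists>G \<epsilon>. pseudo_inverse C D F G \<epsilon>)"

section \<open>Path components and iterated fibre products\<close>

definition component :: "('o, 'a) category \<Rightarrow> 'o \<Rightarrow> 'o set" where
  "component C x =
    {y. (x, y) \<in> ({(Dom C f, Cod C f) |f. f \<in> Arr C} \<union> {(Cod C f, Dom C f) |f. f \<in> Arr C})\<^sup>*}"

definition discrete :: "'o set \<Rightarrow> ('o, 'o) category" where
  "discrete S =
    \<lparr>Obj = S, Arr = S, Dom = (\<lambda>x. x), Cod = (\<lambda>x. x), Ident = (\<lambda>x. x), Comp = (\<lambda>y x. x)\<rparr>"

definition components :: "('o, 'a) category \<Rightarrow> ('o set, 'o set) category" where
  "components C = discrete (component C ` Obj C)"

definition quotient_functor :: "('o, 'a) category \<Rightarrow> ('o, 'a, 'o set, 'o set) cfunctor" where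
  "quotient_functor C = \<lparr>FObj = component C, FArr = (\<lambda>f. component C (Dom C f))\<rparr>"

text \<open>For \<open>n \<ge> 1\<close> and functors \<open>S, T : C \<rightarrow> E\<close>, the \<open>n\<close>-fold fibre product of \<open>C\<close> over
  \<open>E\<close>: the tuples \<open>[x\<^sub>1, \<dots>, x\<^sub>n]\<close> with \<open>T x\<^sub>i = S x\<^sub>i\<^sub>+\<^sub>1\<close>, on objects and on arrows. Tuples
  are thus listed in diagrammatic order.\<close>

definition composable_chain :: "nat \<Rightarrow> 'x set \<Rightarrow> ('x \<Rightarrow> 'y) \<Rightarrow> ('x \<Rightarrow> 'y) \<Rightarrow> 'x list \<Rightarrow> bool" where
  "composable_chain n A S T xs \<longleftrightarrow> length xs = n \<and> set xs \<subseteq> A \<and>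
     (\<forall>i. Suc i < n \<longrightarrow> T (xs ! i) = S (xs ! Suc i))"

definition fibre_power ::
  "nat \<Rightarrow> ('o, 'a) category \<Rightarrow> ('o, 'a, 'p, 'b) cfunctor \<Rightarrow> ('o, 'a, 'p, 'b) cfunctor \<Rightarrow>
   ('o list, 'a list) category" where
  "fibre_power n C S T =
    \<lparr>Obj = Collect (composable_chain n (Obj C) (FObj S) (FObj T)),
     Arr = Collect (composable_chain n (Arr C) (FArr S) (FArr T)),
     Dom = map (Dom C), Cod = map (Cod C), Ident = map (Ident C), Comp = map2 (Comp C)\<rparr>"

section \<open>Weakly globular double categories\<close>

text \<open>Objects of \<open>VCat X\<close> are the objects and its arrows the vertical arrows; objects of
  \<open>HCat X\<close> are the horizontal arrows and its arrows the double cells. A cell \<open>c\<close> has top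
  \<open>Dom (HCat X) c\<close>, bottom \<open>Cod (HCat X) c\<close>, left side \<open>FArr (hdom X) c\<close> and right side
  \<open>FArr (hcod X) c\<close>. Horizontal composition takes the two-element lists of
  \<^const>\<open>fibre_power\<close>, so the composite of \<open>f\<close> followed by \<open>g\<close> is \<open>FObj (hcomp X) [f, g]\<close>.\<close>

record ('o, 'v, 'h, 'c) double_cat =
  VCat :: "('o, 'v) category"
  HCat :: "('h, 'c) category"
  hdom :: "('h, 'c, 'o, 'v) cfunctor"
  hcod :: "('h, 'c, 'o, 'v) cfunctor"
  hid :: "('o, 'v, 'h, 'c) cfunctor"
  hcomp :: "('h list, 'c list, 'h, 'c) cfunctor"

definition strict_chains ::
  "('o, 'v, 'h, 'c) double_cat \<Rightarrow> nat \<Rightarrow> ('h list, 'c list) category" where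
  "strict_chains X n = fibre_power n (HCat X) (hdom X) (hcod X)"

definition weak_chains ::
  "('o, 'v, 'h, 'c) double_cat \<Rightarrow> nat \<Rightarrow> ('h list, 'c list) category" where
  "weak_chains X n = fibre_power n (HCat X)
     (comp_functor (quotient_functor (VCat X)) (hdom X))
     (comp_functor (quotient_functor (VCat X)) (hcod X))"

definition internal_category_laws ::
  "'x set \<Rightarrow> 'y set \<Rightarrow> ('y \<Rightarrow> 'x) \<Rightarrow> ('y \<Rightarrow> 'x) \<Rightarrow> ('x \<Rightarrow> 'y) \<Rightarrow> ('y list \<Rightarrow> 'y) \<Rightarrow> bool" where
  "internal_category_laws A B d\<^sub>0 d\<^sub>1 i c \<longleftrightarrow>
    (\<forall>x\<in>A. d\<^sub>0 (i x) = x \<and> d\<^sub>1 (i x) = x) \<and>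
    (\<forall>f\<in>B. \<forall>g\<in>B. d\<^sub>1 f = d\<^sub>0 g \<longrightarrow> d\<^sub>0 (c [f, g]) = d\<^sub>0 f \<and> d\<^sub>1 (c [f, g]) = d\<^sub>1 g) \<and>
    (\<forall>f\<in>B. c [i (d\<^sub>0 f), f] = f \<and> c [f, i (d\<^sub>1 f)] = f) \<and>
    (\<forall>f\<in>B. \<forall>g\<in>B. \<forall>h\<in>B. d\<^sub>1 f = d\<^sub>0 g \<longrightarrow> d\<^sub>1 g = d\<^sub>0 h \<longrightarrow> c [c [f, g], h] = c [f, c [g, h]])"

definition is_double_category :: "('o, 'v, 'h, 'c) double_cat \<Rightarrow> bool" where
  "is_double_category X \<longleftrightarrow>
    is_category (VCat X) \<and> is_category (HCat X) \<and>
    is_functor (HCat X) (VCat X) (hdom X) \<and> is_functor (HCat X) (VCat X) (hcod X) \<and>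
    is_functor (VCat X) (HCat X) (hid X) \<and>
    is_functor (strict_chains X 2) (HCat X) (hcomp X) \<and>
    internal_category_laws (Obj (VCat X)) (Obj (HCat X))
      (FObj (hdom X)) (FObj (hcod X)) (FObj (hid X)) (FObj (hcomp X)) \<and>
    internal_category_laws (Arr (VCat X)) (Arr (HCat X))
      (FArr (hdom X)) (FArr (hcod X)) (FArr (hid X)) (FArr (hcomp X))"

text \<open>The functors from strict to weak chains induced by the quotient functor do not change
  the underlying tuples, hence \<^const>\<open>id_functor\<close>.\<close>

definition weakly_globular :: "('o, 'v, 'h, 'c) double_cat \<Rightarrow> bool" where
  "weakly_globular X \<longleftrightarrow> is_double_category X \<and>
    is_equivalence (VCat X) (components (VCat X)) (quotient_functor (VCat X)) \<and>
    (\<forall>n\<ge>2. is_equivalence (strict_chains X n) (weak_chains X n) id_functor)"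

section \<open>Companions and pre-companions\<close>

text \<open>\<open>is_cell X c t l r b\<close>: the double cell \<open>c\<close> has top \<open>t\<close>, left side \<open>l\<close>, right side \<open>r\<close>
  and bottom \<open>b\<close>.\<close>

definition is_cell ::
  "('o, 'v, 'h, 'c) double_cat \<Rightarrow> 'c \<Rightarrow> 'h \<Rightarrow> 'v \<Rightarrow> 'v \<Rightarrow> 'h \<Rightarrow> bool" where
  "is_cell X c t l r b \<longleftrightarrow> c \<in> Arr (HCat X) \<and>
     Dom (HCat X) c = t \<and> FArr (hdom X) c = l \<and>
     FArr (hcod X) c = r \<and> Cod (HCat X) c = b"

definition companions :: "('o, 'v, 'h, 'c) double_cat \<Rightarrow> 'h \<Rightarrow> 'v \<Rightarrow> bool" where
  "companions X f v \<longleftrightarrow> f \<in> Obj (HCat X) \<and> v \<in> Arr (VCat X) \<and>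
    (let A = FObj (hdom X) f; B = FObj (hcod X) f in
      Dom (VCat X) v = A \<and> Cod (VCat X) v = B \<and>
      (\<exists>\<psi> \<chi>.
         is_cell X \<psi> (FObj (hid X) A) (Ident (VCat X) A) v f \<and>
         is_cell X \<chi> f v (Ident (VCat X) B) (FObj (hid X) B) \<and>
         FArr (hcomp X) [\<psi>, \<chi>] = Ident (HCat X) f \<and>
         Comp (HCat X) \<chi> \<psi> = FArr (hid X) v))"

definition is_companion :: "('o, 'v, 'h, 'c) double_cat \<Rightarrow> 'h \<Rightarrow> bool" where
  "is_companion X f \<longleftrightarrow> (\<exists>v. companions X f v)"

definition left_pre_companion :: "('o, 'v, 'h, 'c) double_cat \<Rightarrow> 'h \<Rightarrow> bool" where
  "left_pre_companion X f \<longleftrightarrow> (\<exists>f'\<in>Obj (HCat X). \<exists>r\<in>Obj (HCat X).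
     isomorphic_objects (HCat X) f f' \<and> FObj (hcod X) f' = FObj (hdom X) r \<and>
     is_companion X (FObj (hcomp X) [f', r]))"

definition right_pre_companion :: "('o, 'v, 'h, 'c) double_cat \<Rightarrow> 'h \<Rightarrow> bool" where
  "right_pre_companion X f \<longleftrightarrow> (\<exists>f''\<in>Obj (HCat X). \<exists>l\<in>Obj (HCat X).
     isomorphic_objects (HCat X) f f'' \<and> FObj (hcod X) l = FObj (hdom X) f'' \<and>
     is_companion X (FObj (hcomp X) [l, f'']))"

definition pre_companion :: "('o, 'v, 'h, 'c) double_cat \<Rightarrow> 'h \<Rightarrow> bool" where
  "pre_companion X f \<longleftrightarrow> left_pre_companion X f \<and> right_pre_companion X f"

section \<open>Bicategories\<close>

text \<open>The data of a bicategory. \<open>BComp B g f\<close> and \<open>BComp2 B \<beta> \<alpha>\<close> are the horizontal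
  composites of 1-cells and of 2-cells, in applicative order; the associator
  \<open>BAssoc B h g f\<close> goes from \<open>(h g) f\<close> to \<open>h (g f)\<close>, and the unitors go from \<open>1 f\<close> and
  \<open>f 1\<close> to \<open>f\<close>.\<close>

record ('o, 'f, 'c) bicat =
  BObj :: "'o set"
  BHom :: "'o \<Rightarrow> 'o \<Rightarrow> ('f, 'c) category"
  BComp :: "'f \<Rightarrow> 'f \<Rightarrow> 'f"
  BComp2 :: "'c \<Rightarrow> 'c \<Rightarrow> 'c"
  BUnit :: "'o \<Rightarrow> 'f"
  BAssoc :: "'f \<Rightarrow> 'f \<Rightarrow> 'f \<Rightarrow> 'c"
  BLunit :: "'f \<Rightarrow> 'c"
  BRunit :: "'f \<Rightarrow> 'c"

definition is_bicat_equivalence :: "('o, 'f, 'c) bicat \<Rightarrow> 'o \<Rightarrow> 'o \<Rightarrow> 'f \<Rightarrow> bool" where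
  "is_bicat_equivalence B a b f \<longleftrightarrow> a \<in> BObj B \<and> b \<in> BObj B \<and> f \<in> Obj (BHom B a b) \<and>
    (\<exists>g\<in>Obj (BHom B b a).
       isomorphic_objects (BHom B a a) (BComp B g f) (BUnit B a) \<and>
       isomorphic_objects (BHom B b b) (BComp B f g) (BUnit B b))"

section \<open>The fundamental bicategory\<close>

text \<open>The choices on which the fundamental bicategory depends: a pseudo-inverse \<open>\<mu>\<close> of the
  functor from strict to weak pairs, with its counit \<open>\<epsilon>\<close>, whose component at \<open>[f, g]\<close> is the
  pair of vertically invertible cells from \<open>\<mu> [f, g]\<close> to \<open>f\<close> and \<open>g\<close>; and an object \<open>\<theta> a\<close>
  in every component \<open>a\<close>.\<close>

definition bic_choices ::
  "('o, 'v, 'h, 'c) double_cat \<Rightarrow> ('h list, 'c list, 'h list, 'c list) cfunctor \<Rightarrow>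
   ('h list \<Rightarrow> 'c list) \<Rightarrow> ('o set \<Rightarrow> 'o) \<Rightarrow> bool" where
  "bic_choices X \<mu> \<epsilon> \<theta> \<longleftrightarrow>
     pseudo_inverse (strict_chains X 2) (weak_chains X 2) id_functor \<mu> \<epsilon> \<and>
     (\<forall>a\<in>Obj (components (VCat X)). \<theta> a \<in> a)"

definition bic_hom ::
  "('o, 'v, 'h, 'c) double_cat \<Rightarrow> 'o set \<Rightarrow> 'o set \<Rightarrow> ('h, 'c) category" where
  "bic_hom X a b =
    (let H = {f \<in> Obj (HCat X). component (VCat X) (FObj (hdom X) f) = a \<and>
                               component (VCat X) (FObj (hcod X) f) = b}
     in (HCat X)\<lparr>Obj := H, Arr := {c \<in> Arr (HCat X). Dom (HCat X) c \<in> H \<and> Cod (HCat X) c \<in> H}\<rparr>)"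

text \<open>Let \<open>\<alpha> : f' \<rightarrow> f\<close> and \<open>\<beta> : g' \<rightarrow> g\<close> be cells with \<open>[f', g']\<close> a strict pair. The
  weak-pair arrow \<open>\<epsilon>\<^sup>-\<^sup>1 \<cdot> [\<alpha>, \<beta>] : [f', g'] \<rightarrow> \<mu> [f, g]\<close> is between strict pairs, hence is itself
  strict because the inclusion is full; composing it horizontally gives a canonical cell
  from \<open>g' \<circ> f'\<close> to the composite of \<open>f\<close> and \<open>g\<close> in the fundamental bicategory.\<close>

definition bic_compare ::
  "('o, 'v, 'h, 'c) double_cat \<Rightarrow> ('h list \<Rightarrow> 'c list) \<Rightarrow> 'c \<Rightarrow> 'c \<Rightarrow> 'c" where
  "bic_compare X \<epsilon> \<alpha> \<beta> =
    (let W = weak_chains X 2 in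
     FArr (hcomp X) (Comp W (inverse_arrow W (\<epsilon> (Cod W [\<alpha>, \<beta>]))) [\<alpha>, \<beta>]))"

text \<open>The associator compares both bracketings with the composite of any strict triple
  vertically isomorphic to \<open>[f, g, h]\<close>; the unitors compare with the strict composites
  \<open>Id \<circ> f\<close> and \<open>f \<circ> Id\<close>, along the vertical arrow to the chosen object \<open>\<theta>\<close>.\<close>

definition bic_assoc ::
  "('o, 'v, 'h, 'c) double_cat \<Rightarrow> ('h list \<Rightarrow> 'c list) \<Rightarrow> 'h \<Rightarrow> 'h \<Rightarrow> 'h \<Rightarrow> 'c" where
  "bic_assoc X \<epsilon> h g f = (THE a. \<exists>\<alpha> \<beta> \<gamma>.
     invertible (HCat X) \<alpha> \<and> invertible (HCat X) \<beta> \<and> invertible (HCat X) \<gamma> \<and>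
     map (Dom (HCat X)) [\<alpha>, \<beta>, \<gamma>] \<in> Obj (strict_chains X 3) \<and>
     map (Cod (HCat X)) [\<alpha>, \<beta>, \<gamma>] = [f, g, h] \<and>
     (let L = bic_compare X \<epsilon> \<alpha> (bic_compare X \<epsilon> \<beta> \<gamma>);
          R = bic_compare X \<epsilon> (bic_compare X \<epsilon> \<alpha> \<beta>) \<gamma>
      in a \<in> Arr (HCat X) \<and> Dom (HCat X) a = Cod (HCat X) L \<and> Cod (HCat X) a = Cod (HCat X) R \<and>
         Comp (HCat X) a L = R))"

definition bic_lunit ::
  "('o, 'v, 'h, 'c) double_cat \<Rightarrow> ('h list \<Rightarrow> 'c list) \<Rightarrow> ('o set \<Rightarrow> 'o) \<Rightarrow> 'h \<Rightarrow> 'c" where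
  "bic_lunit X \<epsilon> \<theta> f = (THE l. \<exists>v\<in>Arr (VCat X).
     Dom (VCat X) v = FObj (hcod X) f \<and>
     Cod (VCat X) v = \<theta> (component (VCat X) (FObj (hcod X) f)) \<and>
     inverse_arrows (HCat X) (bic_compare X \<epsilon> (Ident (HCat X) f) (FArr (hid X) v)) l)"

definition bic_runit ::
  "('o, 'v, 'h, 'c) double_cat \<Rightarrow> ('h list \<Rightarrow> 'c list) \<Rightarrow> ('o set \<Rightarrow> 'o) \<Rightarrow> 'h \<Rightarrow> 'c" where
  "bic_runit X \<epsilon> \<theta> f = (THE r. \<exists>v\<in>Arr (VCat X).
     Dom (VCat X) v = FObj (hdom X) f \<and>
     Cod (VCat X) v = \<theta> (component (VCat X) (FObj (hdom X) f)) \<and>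
     inverse_arrows (HCat X) (bic_compare X \<epsilon> (FArr (hid X) v) (Ident (HCat X) f)) r)"

definition fundamental_bicat ::
  "('o, 'v, 'h, 'c) double_cat \<Rightarrow> ('h list, 'c list, 'h list, 'c list) cfunctor \<Rightarrow>
   ('h list \<Rightarrow> 'c list) \<Rightarrow> ('o set \<Rightarrow> 'o) \<Rightarrow> ('o set, 'h, 'c) bicat" where
  "fundamental_bicat X \<mu> \<epsilon> \<theta> =
    \<lparr>BObj = Obj (components (VCat X)),
     BHom = bic_hom X,
     BComp = (\<lambda>g f. FObj (hcomp X) (FObj \<mu> [f, g])),
     BComp2 = (\<lambda>\<beta> \<alpha>. FArr (hcomp X) (FArr \<mu> [\<alpha>, \<beta>])),
     BUnit = (\<lambda>a. FObj (hid X) (\<theta> a)),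
     BAssoc = bic_assoc X \<epsilon>,
     BLunit = bic_lunit X \<epsilon> \<theta>,
     BRunit = bic_runit X \<epsilon> \<theta>\<rparr>"

end

theory Submission
  imports Defs
begin

text \<open>Since the vertical category is equivalent to a discrete one, there is exactly one vertical
  arrow between any two objects of a component. Hence vertically isomorphic horizontal arrows
  have isomorphic composites, and \<open>h : A \<rightarrow> B\<close> is a companion if and only if it is vertically
  isomorphic to \<open>Id\<^sub>A\<close>. So \<open>f\<close> is a left (right) pre-companion precisely when it has a one-sided
  inverse \<open>r\<close> (\<open>l\<close>) up to isomorphism in the fundamental bicategory, and the usual argument
  \<open>r \<cong> l\<close>, carried out on a strict replacement of the chain \<open>l, f, r\<close>, gives a two-sided one.\<close>

section \<open>Isomorphisms in a category\<close>

lemma inverse_arrows_sym: "inverse_arrows C f g \<Longrightarrow> inverse_arrows C g f"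
  by (auto simp: inverse_arrows_def)

context
  fixes C :: "('o, 'a) category"
  assumes C: "is_category C"
begin

lemma dom_cod_in_Obj: "f \<in> Arr C \<Longrightarrow> Dom C f \<in> Obj C \<and> Cod C f \<in> Obj C"
  using C by (auto simp: is_category_def)

lemma Ident_arr: "x \<in> Obj C \<Longrightarrow> Ident C x \<in> Arr C \<and> Dom C (Ident C x) = x \<and> Cod C (Ident C x) = x"
  using C by (auto simp: is_category_def)

lemma Comp_arr:
  "\<lbrakk>f \<in> Arr C; g \<in> Arr C; Cod C f = Dom C g\<rbrakk>
   \<Longrightarrow> Comp C g f \<in> Arr C \<and> Dom C (Comp C g f) = Dom C f \<and> Cod C (Comp C g f) = Cod C g"
  using C by (auto simp: is_category_def)

lemma Comp_Ident: "f \<in> Arr C \<Longrightarrow> Comp C f (Ident C (Dom C f)) = f \<and> Comp C (Ident C (Cod C f)) f = f"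
  using C by (auto simp: is_category_def)

lemma Comp_assoc:
  "\<lbrakk>f \<in> Arr C; g \<in> Arr C; h \<in> Arr C; Cod C f = Dom C g; Cod C g = Dom C h\<rbrakk>
   \<Longrightarrow> Comp C h (Comp C g f) = Comp C (Comp C h g) f"
  using C by (auto simp: is_category_def)

lemma Comp_inverse_cancel:
  assumes "inverse_arrows C g g'" "f \<in> Arr C" "Cod C f = Dom C g"
  shows "Comp C g' (Comp C g f) = f"
  using assms Comp_assoc[of f g g'] Comp_Ident[of f] by (auto simp: inverse_arrows_def)

lemma inverse_arrows_Comp:
  assumes f: "inverse_arrows C f f'" and g: "inverse_arrows C g g'" and fg: "Cod C f = Dom C g"
  shows "inverse_arrows C (Comp C g f) (Comp C f' g')"
proof -
  note a = f[unfolded inverse_arrows_def] g[unfolded inverse_arrows_def]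
  have gf: "Comp C g f \<in> Arr C" "Dom C (Comp C g f) = Dom C f" "Cod C (Comp C g f) = Cod C g"
    using a fg Comp_arr[of f g] by auto
  have fg': "Comp C f' g' \<in> Arr C" "Dom C (Comp C f' g') = Cod C g" "Cod C (Comp C f' g') = Dom C f"
    using a fg Comp_arr[of g' f'] by auto
  have "Comp C (Comp C f' g') (Comp C g f) = Comp C f' (Comp C g' (Comp C g f))"
    using Comp_assoc[of "Comp C g f" g' f'] a fg gf by simp
  also have "\<dots> = Ident C (Dom C f)"
    using Comp_inverse_cancel[OF g, of f] a fg by simp
  finally have 1: "Comp C (Comp C f' g') (Comp C g f) = Ident C (Dom C f)" .
  have "Comp C (Comp C g f) (Comp C f' g') = Comp C g (Comp C f (Comp C f' g'))"
    using Comp_assoc[of "Comp C f' g'" f g] a fg fg' by simp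
  also have "\<dots> = Ident C (Cod C g)"
    using Comp_inverse_cancel[OF inverse_arrows_sym[OF f], of g'] a fg by simp
  finally show ?thesis
    using 1 gf fg' by (simp add: inverse_arrows_def)
qed

lemma isomorphic_objects_refl: "x \<in> Obj C \<Longrightarrow> isomorphic_objects C x x"
  unfolding isomorphic_objects_def invertible_def inverse_arrows_def
  using Ident_arr[of x] Comp_Ident[of "Ident C x"] by metis

lemma isomorphic_objects_sym: "isomorphic_objects C x y \<Longrightarrow> isomorphic_objects C y x"
  unfolding isomorphic_objects_def invertible_def inverse_arrows_def by metis

lemma isomorphic_objects_trans:
  assumes "isomorphic_objects C x y" and "isomorphic_objects C y z"
  shows "isomorphic_objects C x z"
proof -
  from assms obtain f f' g g' where fg: "inverse_arrows C f f'" "inverse_arrows C g g'"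
    and e: "Dom C f = x" "Cod C f = y" "Dom C g = y" "Cod C g = z"
    unfolding isomorphic_objects_def invertible_def by blast
  show ?thesis
    unfolding isomorphic_objects_def invertible_def
    using inverse_arrows_Comp[OF fg] Comp_arr[of f g] fg e
    by (metis inverse_arrows_def)
qed

end

lemma isomorphic_objects_in_Obj:
  "\<lbrakk>is_category C; isomorphic_objects C x y\<rbrakk> \<Longrightarrow> x \<in> Obj C \<and> y \<in> Obj C"
  unfolding isomorphic_objects_def invertible_def inverse_arrows_def
  by (metis dom_cod_in_Obj)

lemma functor_inverse_arrows:
  assumes "is_functor C D F" and "inverse_arrows C f g" and "Dom C f \<in> Obj C" and "Cod C f \<in> Obj C"
  shows "inverse_arrows D (FArr F f) (FArr F g)"
  using assms unfolding is_functor_def inverse_arrows_def by metis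

section \<open>Path components\<close>

lemma component_refl: "x \<in> component C x"
  by (simp add: component_def)

text \<open>The generating relation contains each edge in both directions, so its reflexive
  transitive closure is an equivalence relation.\<close>

lemma component_eq:
  assumes "y \<in> component C x"
  shows "component C y = component C x"
proof -
  let ?R = "{(Dom C f, Cod C f) |f. f \<in> Arr C} \<union> {(Cod C f, Dom C f) |f. f \<in> Arr C}"
  have "sym (?R\<^sup>*)"
    by (rule sym_rtrancl) (auto simp: sym_def)
  moreover have "(x, y) \<in> ?R\<^sup>*"
    using assms by (simp add: component_def)
  ultimately show ?thesis
    unfolding component_def by (auto dest: symD intro: rtrancl_trans)
qed

lemma component_Dom_Cod: "f \<in> Arr C \<Longrightarrow> component C (Dom C f) = component C (Cod C f)"
  by (rule component_eq[symmetric]) (auto simp: component_def)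

section \<open>Weakly globular double categories\<close>

locale weakly_globular_double_category =
  fixes X :: "('o, 'v, 'h, 'c) double_cat"
  assumes wg: "weakly_globular X"
begin

abbreviation "V \<equiv> VCat X"
abbreviation "H \<equiv> HCat X"
abbreviation "src \<equiv> FObj (hdom X)"
abbreviation "tgt \<equiv> FObj (hcod X)"
abbreviation "lft \<equiv> FArr (hdom X)"
abbreviation "rgt \<equiv> FArr (hcod X)"
abbreviation "hId \<equiv> FObj (hid X)"
abbreviation "cmp \<equiv> component V"
abbreviation hcomposite (infixr "\<odot>" 75) where "f \<odot> g \<equiv> FObj (hcomp X) [f, g]"
abbreviation hjuxtapose (infixr "\<star>" 75) where "\<alpha> \<star> \<beta> \<equiv> FArr (hcomp X) [\<alpha>, \<beta>]"
abbreviation vcomposite (infixr "\<cdot>" 70) where "\<beta> \<cdot> \<alpha> \<equiv> Comp H \<beta> \<alpha>"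
abbreviation viso (infix "\<cong>" 50) where "f \<cong> g \<equiv> isomorphic_objects H f g"

lemma V: "is_category V" and H: "is_category H"
  and hdom: "is_functor H V (hdom X)" and hcod: "is_functor H V (hcod X)"
  and hid: "is_functor V H (hid X)" and hcomp: "is_functor (strict_chains X 2) H (hcomp X)"
  and laws0: "internal_category_laws (Obj V) (Obj H) src tgt hId (FObj (hcomp X))"
  and laws1: "internal_category_laws (Arr V) (Arr H) lft rgt (FArr (hid X)) (FArr (hcomp X))"
  and V_equiv: "is_equivalence V (components V) (quotient_functor V)"
  and chains_equiv: "n \<ge> 2 \<Longrightarrow> is_equivalence (strict_chains X n) (weak_chains X n) id_functor"
  using wg by (auto simp: weakly_globular_def is_double_category_def)

lemmas isos = isomorphic_objects_refl[OF H] isomorphic_objects_sym[OF H]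
  isomorphic_objects_trans[OF H]

lemma src_tgt:
  "f \<in> Obj H \<Longrightarrow> src f \<in> Obj V \<and> tgt f \<in> Obj V"
  "x \<in> Obj V \<Longrightarrow> hId x \<in> Obj H \<and> src (hId x) = x \<and> tgt (hId x) = x"
  using hdom hcod hid laws0 by (auto simp: is_functor_def internal_category_laws_def)

lemma lft_rgt:
  assumes "\<alpha> \<in> Arr H"
  shows "lft \<alpha> \<in> Arr V" "rgt \<alpha> \<in> Arr V"
    "Dom V (lft \<alpha>) = src (Dom H \<alpha>)" "Cod V (lft \<alpha>) = src (Cod H \<alpha>)"
    "Dom V (rgt \<alpha>) = tgt (Dom H \<alpha>)" "Cod V (rgt \<alpha>) = tgt (Cod H \<alpha>)"
  using assms hdom hcod by (auto simp: is_functor_def)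

lemma hid_cell:
  assumes "v \<in> Arr V"
  shows "FArr (hid X) v \<in> Arr H" "Dom H (FArr (hid X) v) = hId (Dom V v)"
    "Cod H (FArr (hid X) v) = hId (Cod V v)" "lft (FArr (hid X) v) = v" "rgt (FArr (hid X) v) = v"
  using assms hid laws1 by (auto simp: is_functor_def internal_category_laws_def)

lemma hcomposite:
  assumes "f \<in> Obj H" "g \<in> Obj H" "tgt f = src g"
  shows "f \<odot> g \<in> Obj H" "src (f \<odot> g) = src f" "tgt (f \<odot> g) = tgt g"
proof -
  have "[f, g] \<in> Obj (strict_chains X 2)"
    using assms by (auto simp: strict_chains_def fibre_power_def composable_chain_def)
  then show "f \<odot> g \<in> Obj H"
    using hcomp by (auto simp: is_functor_def)
qed (use assms laws0 in \<open>auto simp: internal_category_laws_def\<close>)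

lemma strict_pair_arr:
  "\<lbrakk>\<alpha> \<in> Arr H; \<beta> \<in> Arr H; rgt \<alpha> = lft \<beta>\<rbrakk> \<Longrightarrow> [\<alpha>, \<beta>] \<in> Arr (strict_chains X 2)"
  by (auto simp: strict_chains_def fibre_power_def composable_chain_def)

text \<open>This is functoriality of \<open>hcomp X\<close>, because composition of strict pairs is
  computed entrywise.\<close>

lemma interchange:
  assumes "\<alpha> \<in> Arr H" "\<beta> \<in> Arr H" "rgt \<alpha> = lft \<beta>"
    and "\<alpha>' \<in> Arr H" "\<beta>' \<in> Arr H" "rgt \<alpha>' = lft \<beta>'"
    and "Cod H \<alpha> = Dom H \<alpha>'" "Cod H \<beta> = Dom H \<beta>'"
  shows "(\<alpha>' \<cdot> \<alpha>) \<star> (\<beta>' \<cdot> \<beta>) = (\<alpha>' \<star> \<beta>') \<cdot> (\<alpha> \<star> \<beta>)"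
proof -
  let ?S = "strict_chains X 2"
  have "[\<alpha>, \<beta>] \<in> Arr ?S" "[\<alpha>', \<beta>'] \<in> Arr ?S"
    using assms by (auto intro: strict_pair_arr)
  moreover have "Cod ?S [\<alpha>, \<beta>] = Dom ?S [\<alpha>', \<beta>']"
    and "Comp ?S [\<alpha>', \<beta>'] [\<alpha>, \<beta>] = [\<alpha>' \<cdot> \<alpha>, \<beta>' \<cdot> \<beta>]"
    using assms by (auto simp: strict_chains_def fibre_power_def)
  ultimately show ?thesis
    using hcomp unfolding is_functor_def by metis
qed

section \<open>The vertical category: at most one arrow between two objects, and every arrow
  invertible\<close>

text \<open>As the target of the quotient functor is discrete, naturality of the unit \<open>\<eta>\<close> makes it a
  cone with one vertex \<open>z a\<close> for each component \<open>a\<close>.\<close>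

lemma V_unit:
  obtains \<eta> z where "\<And>x. x \<in> Obj V \<Longrightarrow>
      \<exists>k. inverse_arrows V (\<eta> x) k \<and> Dom V (\<eta> x) = x \<and> Cod V (\<eta> x) = z (cmp x)"
    and "\<And>u. u \<in> Arr V \<Longrightarrow> Comp V (\<eta> (Cod V u)) u = \<eta> (Dom V u)"
proof -
  from V_equiv obtain G \<eta> where G: "is_functor (components V) V G"
    and \<eta>: "natural_iso V V id_functor (comp_functor G (quotient_functor V)) \<eta>"
    by (auto simp: is_equivalence_def pseudo_inverse_def)
  have \<eta>_iso: "\<exists>k. inverse_arrows V (\<eta> x) k \<and> Dom V (\<eta> x) = x \<and> Cod V (\<eta> x) = FObj G (cmp x)"
    if "x \<in> Obj V" for x
    using \<eta> that
    by (auto simp: natural_iso_def invertible_def id_functor_def comp_functor_def quotient_functor_def)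
  have "Comp V (\<eta> (Cod V u)) u = \<eta> (Dom V u)" if u: "u \<in> Arr V" for u
  proof -
    let ?x = "Dom V u"
    have x: "?x \<in> Obj V"
      using dom_cod_in_Obj[OF V u] by simp
    have "Comp V (\<eta> (Cod V u)) u = Comp V (FArr G (cmp ?x)) (\<eta> ?x)"
      using \<eta> u by (auto simp: natural_iso_def id_functor_def comp_functor_def quotient_functor_def)
    \<comment> \<open>In the discrete category \<open>components V\<close> the arrow
      \<open>cmp ?x\<close> is its own object and its own identity.\<close>
    also have "FArr G (cmp ?x) = Ident V (FObj G (cmp ?x))"
      using G x unfolding is_functor_def components_def discrete_def by simp
    also have "Comp V (Ident V (FObj G (cmp ?x))) (\<eta> ?x) = \<eta> ?x"
      using \<eta>_iso[OF x] Comp_Ident[OF V] by (metis inverse_arrows_def)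
    finally show ?thesis .
  qed
  with \<eta>_iso show thesis
    by (rule that)
qed

text \<open>The cone equation says that \<eta> at the codomain of \<open>w\<close>, composed with
  \<open>w\<close>, is \<eta> at its domain. Cancelling the invertible component of \<eta> expresses
  \<open>w\<close> by its end points alone.\<close>

lemma V_thin:
  assumes "u \<in> Arr V" "v \<in> Arr V" "Dom V u = Dom V v" "Cod V u = Cod V v"
  shows "u = v"
proof -
  obtain \<eta> z where \<eta>: "\<And>x. x \<in> Obj V \<Longrightarrow>
      \<exists>k. inverse_arrows V (\<eta> x) k \<and> Dom V (\<eta> x) = x \<and> Cod V (\<eta> x) = z (cmp x)"
    and nat: "\<And>u. u \<in> Arr V \<Longrightarrow> Comp V (\<eta> (Cod V u)) u = \<eta> (Dom V u)"
    by (rule V_unit) blast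
  obtain k where k: "inverse_arrows V (\<eta> (Cod V u)) k" and d: "Dom V (\<eta> (Cod V u)) = Cod V u"
    using \<eta> dom_cod_in_Obj[OF V] assms(1) by blast
  have "w = Comp V k (\<eta> (Dom V u))"
    if "w \<in> Arr V" "Dom V w = Dom V u" "Cod V w = Cod V u" for w
    using Comp_inverse_cancel[OF V k that(1)] nat[OF that(1)] that d by simp
  then show ?thesis
    using assms by metis
qed

text \<open>Both objects are isomorphic to the vertex \<open>z\<close> of their common
  component.\<close>

lemma V_connected:
  assumes "x \<in> Obj V" "y \<in> Obj V" "cmp x = cmp y"
  obtains u u' where "inverse_arrows V u u'" "Dom V u = x" "Cod V u = y"
proof -
  obtain \<eta> z where \<eta>: "\<And>x. x \<in> Obj V \<Longrightarrow>
      \<exists>k. inverse_arrows V (\<eta> x) k \<and> Dom V (\<eta> x) = x \<and> Cod V (\<eta> x) = z (cmp x)"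
    by (rule V_unit) blast
  have "isomorphic_objects V x (z (cmp x))" "isomorphic_objects V y (z (cmp x))"
    using \<eta> assms unfolding isomorphic_objects_def invertible_def by metis+
  then have "isomorphic_objects V x y"
    using isomorphic_objects_sym[OF V] isomorphic_objects_trans[OF V] by blast
  then show thesis
    using that by (auto simp: isomorphic_objects_def invertible_def)
qed

text \<open>The ends of \<open>v\<close> share a component, so some invertible arrow is parallel to
  \<open>v\<close>, and thinness identifies the two.\<close>

lemma V_groupoid:
  assumes "v \<in> Arr V"
  obtains w where "inverse_arrows V v w"
proof -
  obtain u u' where u: "inverse_arrows V u u'" "Dom V u = Dom V v" "Cod V u = Cod V v"
    using V_connected dom_cod_in_Obj[OF V assms] component_Dom_Cod[OF assms] by metis
  then have "u = v"
    using assms by (intro V_thin) (auto simp: inverse_arrows_def)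
  with u show thesis
    using that by blast
qed

section \<open>Vertical isomorphism of horizontal arrows and its compatibility with
  composition\<close>

lemma Id_iso:
  assumes "x \<in> Obj V" "y \<in> Obj V" "cmp x = cmp y"
  shows "hId x \<cong> hId y"
proof -
  obtain u u' where u: "inverse_arrows V u u'" "Dom V u = x" "Cod V u = y"
    using V_connected assms by blast
  then have "inverse_arrows H (FArr (hid X) u) (FArr (hid X) u')"
    using functor_inverse_arrows[OF hid] assms by blast
  moreover have "Dom H (FArr (hid X) u) = hId x" "Cod H (FArr (hid X) u) = hId y"
    using u hid_cell[of u] by (auto simp: inverse_arrows_def)
  ultimately show ?thesis
    unfolding isomorphic_objects_def invertible_def by blast
qed

lemma iso_components:
  assumes "f \<cong> g"
  shows "cmp (src f) = cmp (src g)" "cmp (tgt f) = cmp (tgt g)"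
  using assms component_Dom_Cod[of _ V] lft_rgt
  unfolding isomorphic_objects_def invertible_def inverse_arrows_def by metis+

text \<open>Two vertically invertible cells can be juxtaposed only if their inner sides agree. Here
  those sides are parallel vertical arrows, so thinness makes them equal, for the cells and for
  their inverses.\<close>

lemma hcomposite_iso:
  assumes "f \<cong> f'" "g \<cong> g'" "tgt f = src g" "tgt f' = src g'"
  shows "f \<odot> g \<cong> f' \<odot> g'"
proof -
  let ?S = "strict_chains X 2"
  obtain \<alpha> \<alpha>' \<beta> \<beta>' where \<alpha>: "inverse_arrows H \<alpha> \<alpha>'" "Dom H \<alpha> = f" "Cod H \<alpha> = f'"
    and \<beta>: "inverse_arrows H \<beta> \<beta>'" "Dom H \<beta> = g" "Cod H \<beta> = g'"
    using assms unfolding isomorphic_objects_def invertible_def by metis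
  note ar = \<alpha>(1)[unfolded inverse_arrows_def] \<beta>(1)[unfolded inverse_arrows_def]
  have "rgt \<alpha> = lft \<beta>" "rgt \<alpha>' = lft \<beta>'"
    using ar \<alpha> \<beta> assms lft_rgt by (auto intro!: V_thin)
  then have arr: "[\<alpha>, \<beta>] \<in> Arr ?S" "[\<alpha>', \<beta>'] \<in> Arr ?S"
    using ar by (auto intro: strict_pair_arr)
  moreover have ob: "[f, g] \<in> Obj ?S" "[f', g'] \<in> Obj ?S"
    using assms isomorphic_objects_in_Obj[OF H]
    by (auto simp: strict_chains_def fibre_power_def composable_chain_def)
  moreover have dc: "Dom ?S [\<alpha>, \<beta>] = [f, g]" "Cod ?S [\<alpha>, \<beta>] = [f', g']"
    using \<alpha> \<beta> by (auto simp: strict_chains_def fibre_power_def)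
  moreover have "inverse_arrows ?S [\<alpha>, \<beta>] [\<alpha>', \<beta>']"
    using arr ar \<alpha> \<beta> by (auto simp: strict_chains_def fibre_power_def inverse_arrows_def)
  ultimately have "inverse_arrows H (\<alpha> \<star> \<beta>) (\<alpha>' \<star> \<beta>')"
    using functor_inverse_arrows[OF hcomp] by metis
  moreover have "Dom H (\<alpha> \<star> \<beta>) = f \<odot> g" "Cod H (\<alpha> \<star> \<beta>) = f' \<odot> g'"
    using hcomp arr dc by (auto simp: is_functor_def)
  ultimately show ?thesis
    unfolding isomorphic_objects_def invertible_def by blast
qed

section \<open>Companions and isomorphisms to horizontal identities\<close>

text \<open>With \<open>w\<close> the inverse of \<open>v\<close>, the cell \<psi> from the identity
  to \<open>h\<close> has vertical inverse \<open>?i \<cdot> \<chi>\<close>, where \<open>?i\<close>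
  is the horizontal identity cell on \<open>w\<close>. One companion equation yields each of the two
  inverse laws.\<close>

lemma companion_iso_Id:
  assumes "companions X h v"
  shows "h \<cong> hId (src h)"
proof -
  let ?A = "src h" and ?B = "tgt h"
  from assms obtain \<psi> \<chi> where h: "h \<in> Obj H" and v: "v \<in> Arr V" "Dom V v = ?A" "Cod V v = ?B"
    and \<psi>: "\<psi> \<in> Arr H" "Dom H \<psi> = hId ?A" "lft \<psi> = Ident V ?A" "rgt \<psi> = v" "Cod H \<psi> = h"
    and \<chi>: "\<chi> \<in> Arr H" "Dom H \<chi> = h" "lft \<chi> = v" "rgt \<chi> = Ident V ?B" "Cod H \<chi> = hId ?B"
    and \<psi>\<chi>: "\<psi> \<star> \<chi> = Ident H h" and \<chi>\<psi>: "\<chi> \<cdot> \<psi> = FArr (hid X) v"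
    unfolding companions_def Let_def is_cell_def by blast
  obtain w where w: "inverse_arrows V v w"
    using V_groupoid v(1) by blast
  let ?i = "FArr (hid X) w"
  have A: "?A \<in> Obj V" and B: "?B \<in> Obj V"
    using src_tgt h by auto
  have wv: "w \<in> Arr V" "Dom V w = ?B" "Cod V w = ?A"
    using w v by (auto simp: inverse_arrows_def)
  have i: "?i \<in> Arr H" "Dom H ?i = hId ?B" "Cod H ?i = hId ?A"
    using hid_cell wv by auto
  have i\<chi>: "?i \<cdot> \<chi> \<in> Arr H" "Dom H (?i \<cdot> \<chi>) = h" "Cod H (?i \<cdot> \<chi>) = hId ?A"
    using Comp_arr[OF H \<chi>(1) i(1)] \<chi> i by auto
  have "(?i \<cdot> \<chi>) \<cdot> \<psi> = ?i \<cdot> FArr (hid X) v"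
    using Comp_assoc[OF H \<psi>(1) \<chi>(1) i(1)] \<psi> \<chi> i \<chi>\<psi> by simp
  also have "\<dots> = FArr (hid X) (Comp V w v)"
    using hid v wv by (auto simp: is_functor_def)
  also have "\<dots> = Ident H (hId ?A)"
    using w v hid A by (auto simp: is_functor_def inverse_arrows_def)
  finally have left: "(?i \<cdot> \<chi>) \<cdot> \<psi> = Ident H (hId ?A)" .
  \<comment> \<open>The composite in the other order. It fixes \<psi> because the first composite is
    an identity; it remains to show that \<open>e\<close> itself is an identity.\<close>
  define e where "e = \<psi> \<cdot> (?i \<cdot> \<chi>)"
  have e: "e \<in> Arr H" "Dom H e = h" "Cod H e = h"
    using Comp_arr[OF H i\<chi>(1) \<psi>(1)] i\<chi> \<psi> by (auto simp: e_def)
  have e\<psi>: "e \<cdot> \<psi> = \<psi>"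
    using Comp_assoc[OF H \<psi>(1) i\<chi>(1) \<psi>(1)] left i\<chi> \<psi> Comp_Ident[OF H \<psi>(1)]
    by (simp add: e_def)
  have IB: "Ident V ?B \<in> Arr V" "Dom V (Ident V ?B) = ?B" "Cod V (Ident V ?B) = ?B"
    using Ident_arr[OF V B] by auto
  let ?j = "FArr (hid X) (Ident V ?B)"
  \<comment> \<open>Thinness makes the right side of \<open>e\<close> an identity, so juxtaposing
    \<open>?j\<close> on the right leaves \<open>e\<close> unchanged and interchange becomes
    applicable.\<close>
  have rgt_e: "rgt e = Ident V ?B"
    using lft_rgt[OF e(1)] e IB by (intro V_thin) auto
  have j: "?j \<in> Arr H" "Dom H ?j = hId ?B" "lft ?j = Ident V ?B" "?j = Ident H (hId ?B)"
    using hid_cell[OF IB(1)] IB hid B by (auto simp: is_functor_def)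
  text \<open>\<open>e = e \<cdot> (\<psi> \<star> \<chi>) = (e \<cdot> \<psi>) \<star> \<chi> = \<psi> \<star> \<chi>\<close>, by interchange.\<close>
  have "e \<star> ?j = e"
    using laws1 e rgt_e unfolding internal_category_laws_def by metis
  then have "e = (e \<star> ?j) \<cdot> (\<psi> \<star> \<chi>)"
    using \<psi>\<chi> e Comp_Ident[OF H e(1)] by simp
  also have "(e \<star> ?j) \<cdot> (\<psi> \<star> \<chi>) = (e \<cdot> \<psi>) \<star> (?j \<cdot> \<chi>)"
    by (rule interchange[symmetric]) (use e j \<psi> \<chi> rgt_e in auto)
  also have "\<dots> = Ident H h"
    using e\<psi> j Comp_Ident[OF H \<chi>(1)] \<chi> \<psi>\<chi> by simp
  finally have "\<psi> \<cdot> (?i \<cdot> \<chi>) = Ident H h"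
    by (simp add: e_def)
  with left have "inverse_arrows H (?i \<cdot> \<chi>) \<psi>"
    using i\<chi> \<psi> by (auto simp: inverse_arrows_def)
  then show ?thesis
    unfolding isomorphic_objects_def invertible_def using i\<chi> by blast
qed

text \<open>An invertible cell \<psi> from the identity already is one binding cell: thinness turns
  its left side into an identity, and its right side serves as the vertical companion. The other
  cell \<chi> is the inverse of \<psi> followed by the identity cell on that side.\<close>

lemma iso_Id_companion:
  assumes "hId (src h) \<cong> h"
  shows "is_companion X h"
proof -
  let ?A = "src h" and ?B = "tgt h"
  obtain \<psi> \<phi> where inv: "inverse_arrows H \<psi> \<phi>" and \<psi>d: "Dom H \<psi> = hId ?A" "Cod H \<psi> = h"
    using assms by (auto simp: isomorphic_objects_def invertible_def)
  have \<psi>: "\<psi> \<in> Arr H" and \<phi>: "\<phi> \<in> Arr H" "Dom H \<phi> = h" "Cod H \<phi> = hId ?A"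
    and \<phi>\<psi>: "\<phi> \<cdot> \<psi> = Ident H (hId ?A)" and \<psi>\<phi>: "\<psi> \<cdot> \<phi> = Ident H h"
    using inv \<psi>d by (auto simp: inverse_arrows_def)
  have h: "h \<in> Obj H"
    using assms isomorphic_objects_in_Obj[OF H] by blast
  have A: "?A \<in> Obj V" and B: "?B \<in> Obj V"
    using src_tgt h by auto
  note IA = Ident_arr[OF V A] and IB = Ident_arr[OF V B] and IdA = src_tgt(2)[OF A]
  define v where "v = rgt \<psi>"
  have v: "v \<in> Arr V" "Dom V v = ?A" "Cod V v = ?B"
    using lft_rgt[OF \<psi>] \<psi>d IdA by (auto simp: v_def)
  note iv = hid_cell[OF v(1)]
  define \<chi> where "\<chi> = FArr (hid X) v \<cdot> \<phi>"
  have \<chi>: "\<chi> \<in> Arr H" "Dom H \<chi> = h" "Cod H \<chi> = hId ?B"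
    using Comp_arr[OF H \<phi>(1) iv(1)] \<phi> iv v by (auto simp: \<chi>_def)
  \<comment> \<open>Each side is parallel to the claimed vertical arrow, so thinness decides all
    four.\<close>
  have lft\<psi>: "lft \<psi> = Ident V ?A" and lft\<phi>: "lft \<phi> = Ident V ?A"
    and lft\<chi>: "lft \<chi> = v" and rgt\<chi>: "rgt \<chi> = Ident V ?B"
    using lft_rgt[OF \<psi>] lft_rgt[OF \<phi>(1)] lft_rgt[OF \<chi>(1)] \<psi>d \<phi> \<chi> IA IB IdA src_tgt(2)[OF B] v
    by (auto intro!: V_thin)
  have "\<chi> \<cdot> \<psi> = FArr (hid X) v \<cdot> (\<phi> \<cdot> \<psi>)"
    unfolding \<chi>_def by (rule Comp_assoc[OF H, symmetric]) (use \<psi> \<psi>d \<phi> iv v in auto)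
  then have \<chi>\<psi>: "\<chi> \<cdot> \<psi> = FArr (hid X) v"
    using \<phi>\<psi> iv v Comp_Ident[OF H iv(1)] by simp
  let ?j = "FArr (hid X) (Ident V ?A)"
  have j: "?j \<in> Arr H" "Cod H ?j = hId ?A" "rgt ?j = Ident V ?A" "?j = Ident H (hId ?A)"
    using hid_cell[of "Ident V ?A"] IA hid A by (auto simp: is_functor_def)
  \<comment> \<open>Stacking \<open>?j\<close> above \<psi> gives a two-by-two grid with columns
    \<psi> and \<chi>. Read by rows, the horizontal unit laws reduce it to
    \<open>\<psi> \<cdot> \<phi>\<close>.\<close>
  have "\<psi> \<star> \<chi> = (\<psi> \<cdot> ?j) \<star> (FArr (hid X) v \<cdot> \<phi>)"
    using j \<psi> \<psi>d Comp_Ident[OF H \<psi>] by (simp add: \<chi>_def)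
  also have "\<dots> = (\<psi> \<star> FArr (hid X) v) \<cdot> (?j \<star> \<phi>)"
    by (rule interchange) (use \<psi> \<psi>d \<phi> j iv v lft\<phi> in \<open>auto simp: v_def\<close>)
  also have "\<psi> \<star> FArr (hid X) v = \<psi>"
    using laws1 \<psi> by (auto simp: internal_category_laws_def v_def)
  also have "?j \<star> \<phi> = \<phi>"
    using laws1 \<phi> lft\<phi> by (auto simp: internal_category_laws_def)
  finally have "\<psi> \<star> \<chi> = Ident H h"
    using \<psi>\<phi> by simp
  moreover have "is_cell X \<psi> (hId ?A) (Ident V ?A) v h" "is_cell X \<chi> h v (Ident V ?B) (hId ?B)"
    using \<psi> \<psi>d \<chi> lft\<psi> lft\<chi> rgt\<chi> by (auto simp: is_cell_def v_def)
  ultimately have "companions X h v"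
    unfolding companions_def Let_def using h v \<chi>\<psi> by blast
  then show ?thesis
    by (auto simp: is_companion_def)
qed

text \<open>The reference object \<open>x\<close> may be any object in the component of either end
  of \<open>h\<close>: each side of the equivalence forces both ends into one component, where all
  horizontal identities are isomorphic. This freedom covers both the chosen objects
  \<open>\<theta> a\<close> and the ends of a strict replacement.\<close>

lemma is_companion_iff:
  assumes "x \<in> Obj V" "h \<in> Obj H" "cmp (src h) = cmp x \<or> cmp (tgt h) = cmp x"
  shows "is_companion X h \<longleftrightarrow> h \<cong> hId x"
proof
  assume "is_companion X h"
  then have *: "h \<cong> hId (src h)"
    using companion_iso_Id by (auto simp: is_companion_def)
  then have "cmp (src h) = cmp (tgt h)"
    using iso_components(2)[of h] src_tgt assms by simp
  then have "hId (src h) \<cong> hId x"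
    using Id_iso assms src_tgt by metis
  with * show "h \<cong> hId x"
    using isos by blast
next
  assume *: "h \<cong> hId x"
  then have "hId (src h) \<cong> hId x"
    using iso_components(1)[of h] src_tgt assms by (intro Id_iso) auto
  with * show "is_companion X h"
    using isos iso_Id_companion by blast
qed

section \<open>Replacing weak chains by strict ones\<close>

lemma weak_chain_iso:
  assumes "isomorphic_objects (weak_chains X n) xs ys" "length xs = n" "i < n"
  shows "xs ! i \<cong> ys ! i"
proof -
  obtain e e' where inv: "inverse_arrows (weak_chains X n) e e'"
    and d: "map (Dom H) e = xs" "map (Cod H) e = ys"
    using assms
    by (auto simp: isomorphic_objects_def invertible_def weak_chains_def fibre_power_def)
  have len: "length e = n" "length e' = n" "i < n" and set: "set e \<subseteq> Arr H" "set e' \<subseteq> Arr H"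
    and eqs: "map (Dom H) e' = map (Cod H) e" "map (Cod H) e' = map (Dom H) e"
      "map2 (Comp H) e' e = map (Ident H) (map (Dom H) e)"
      "map2 (Comp H) e e' = map (Ident H) (map (Cod H) e)"
    using inv assms
    by (auto simp: inverse_arrows_def weak_chains_def fibre_power_def composable_chain_def)
  \<comment> \<open>Composition and identities of tuples are entrywise, so the inverse laws can be
    read off at position \<open>i\<close>.\<close>
  have "inverse_arrows H (e ! i) (e' ! i)"
    using len set eqs[THEN arg_cong[where f = "\<lambda>l. l ! i"]]
    by (auto simp: inverse_arrows_def intro: nth_mem)
  then show ?thesis
    unfolding isomorphic_objects_def invertible_def using d len by auto
qed

text \<open>Since the comparison functor is \<open>id_functor\<close>, the counit at
  \<open>xs\<close> is an isomorphism of weak chains from the strict chain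
  \<open>FObj \<mu> xs\<close> to \<open>xs\<close> itself.\<close>

lemma strictify:
  assumes "pseudo_inverse (strict_chains X n) (weak_chains X n) id_functor \<mu> \<epsilon>"
    and "xs \<in> Obj (weak_chains X n)"
  shows "FObj \<mu> xs \<in> Obj (strict_chains X n)" "\<And>i. i < n \<Longrightarrow> FObj \<mu> xs ! i \<cong> xs ! i"
proof -
  show *: "FObj \<mu> xs \<in> Obj (strict_chains X n)"
    using assms by (auto simp: pseudo_inverse_def is_functor_def)
  have "isomorphic_objects (weak_chains X n) (FObj \<mu> xs) xs"
    using assms
    by (auto simp: pseudo_inverse_def natural_iso_def isomorphic_objects_def comp_functor_def
        id_functor_def)
  then show "FObj \<mu> xs ! i \<cong> xs ! i" if "i < n" for i
    using weak_chain_iso * that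
    by (auto simp: strict_chains_def fibre_power_def composable_chain_def)
qed

lemma strict_pair:
  assumes "pseudo_inverse (strict_chains X 2) (weak_chains X 2) id_functor \<mu> \<epsilon>"
    and "f \<in> Obj H" "g \<in> Obj H" "cmp (tgt f) = cmp (src g)"
  obtains f' g' where "FObj \<mu> [f, g] = [f', g']" "f' \<cong> f" "g' \<cong> g" "tgt f' = src g'"
proof -
  have "[f, g] \<in> Obj (weak_chains X 2)"
    using assms by (auto simp: weak_chains_def fibre_power_def composable_chain_def
        comp_functor_def quotient_functor_def)
  note s = strictify[OF assms(1) this]
  from s(1) obtain f' g' where eq: "FObj \<mu> [f, g] = [f', g']" and "tgt f' = src g'"
    by (auto simp: strict_chains_def fibre_power_def composable_chain_def length_Suc_conv
        numeral_2_eq_2)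
  with s(2)[of 0] s(2)[of 1] that show thesis
    by simp
qed

text \<open>Weak globularity at \<open>n = 3\<close> replaces all three arrows at once, so both
  adjacent pairs share the same middle arrow. Replacing the pairs separately would not guarantee
  this.\<close>

lemma strict_triple:
  assumes "f \<in> Obj H" "g \<in> Obj H" "h \<in> Obj H"
    and "cmp (tgt f) = cmp (src g)" "cmp (tgt g) = cmp (src h)"
  obtains f' g' h' where "f' \<cong> f" "g' \<cong> g" "h' \<cong> h" "tgt f' = src g'" "tgt g' = src h'"
proof -
  obtain \<mu> \<epsilon> where "pseudo_inverse (strict_chains X 3) (weak_chains X 3) id_functor \<mu> \<epsilon>"
    using chains_equiv[of 3] by (auto simp: is_equivalence_def)
  moreover have "[f, g, h] \<in> Obj (weak_chains X 3)"
    using assms by (auto simp: weak_chains_def fibre_power_def composable_chain_def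
        comp_functor_def quotient_functor_def less_Suc_eq numeral_3_eq_3)
  ultimately have s: "FObj \<mu> [f, g, h] \<in> Obj (strict_chains X 3)"
      "\<And>i. i < 3 \<Longrightarrow> FObj \<mu> [f, g, h] ! i \<cong> [f, g, h] ! i"
    using strictify by blast+
  from s(1) obtain f' g' h' where eq: "FObj \<mu> [f, g, h] = [f', g', h']"
    by (auto simp: strict_chains_def fibre_power_def composable_chain_def length_Suc_conv
        numeral_3_eq_3)
  have "Suc i < 3 \<Longrightarrow> tgt ([f', g', h'] ! i) = src ([f', g', h'] ! Suc i)" for i
    using s(1) eq by (auto simp: strict_chains_def fibre_power_def composable_chain_def)
  from this[of 0] this[of 1] s(2)[of 0] s(2)[of 1] s(2)[of 2] eq that show thesis
    by simp
qed

section \<open>Equivalences in the fundamental bicategory\<close>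

text \<open>\<open>bic_hom X a b\<close> is a full subcategory of \<open>HCat X\<close>, so a cell
  between two of its objects and the inverse of that cell both lie in it.\<close>

lemma bic_hom_iso:
  assumes "f \<in> Obj (bic_hom X a b)" "g \<in> Obj (bic_hom X a b)"
  shows "isomorphic_objects (bic_hom X a b) f g \<longleftrightarrow> f \<cong> g"
proof
  show "isomorphic_objects (bic_hom X a b) f g \<Longrightarrow> f \<cong> g"
    by (auto simp: isomorphic_objects_def invertible_def inverse_arrows_def bic_hom_def Let_def)
next
  assume "f \<cong> g"
  then obtain \<alpha> \<beta> where "inverse_arrows H \<alpha> \<beta>" "Dom H \<alpha> = f" "Cod H \<alpha> = g"
    by (auto simp: isomorphic_objects_def invertible_def)
  then have "inverse_arrows (bic_hom X a b) \<alpha> \<beta>"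
      "Dom (bic_hom X a b) \<alpha> = f" "Cod (bic_hom X a b) \<alpha> = g"
    using assms by (auto simp: inverse_arrows_def bic_hom_def Let_def)
  then show "isomorphic_objects (bic_hom X a b) f g"
    unfolding isomorphic_objects_def invertible_def by blast
qed

text \<open>Being isomorphic to the unit 1-cell, a horizontal identity, is the same as being a
  companion by \<open>is_companion_iff\<close>. This removes \<theta> from the description of
  equivalences.\<close>

lemma bic_equivalence_iff:
  assumes ch: "bic_choices X \<mu> \<epsilon> \<theta>" and f: "f \<in> Obj H"
  shows "is_bicat_equivalence (fundamental_bicat X \<mu> \<epsilon> \<theta>) (cmp (src f)) (cmp (tgt f)) f \<longleftrightarrow>
    (\<exists>g\<in>Obj H. cmp (src g) = cmp (tgt f) \<and> cmp (tgt g) = cmp (src f) \<and>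
      is_companion X (FObj (hcomp X) (FObj \<mu> [f, g])) \<and>
      is_companion X (FObj (hcomp X) (FObj \<mu> [g, f])))"
proof -
  note pi = ch[unfolded bic_choices_def, THEN conjunct1]
  have \<theta>: "\<theta> (cmp x) \<in> Obj V \<and> cmp (\<theta> (cmp x)) = cmp x" if "x \<in> Obj V" for x
  proof -
    have mem: "\<theta> (cmp x) \<in> cmp x"
      using ch that by (auto simp: bic_choices_def components_def discrete_def)
    have "(x, \<theta> (cmp x)) \<in>
        ({(Dom V f, Cod V f) |f. f \<in> Arr V} \<union> {(Cod V f, Dom V f) |f. f \<in> Arr V})\<^sup>*"
      using mem unfolding component_def by simp
    then have "\<theta> (cmp x) \<in> Obj V"
      \<comment> \<open>The path is empty, or its last edge ends at an end point of a vertical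
        arrow; either way the final point is an object.\<close>
      by (cases rule: rtranclE) (use that dom_cod_in_Obj[OF V] in auto)
    with component_eq[OF mem] show ?thesis
      by simp
  qed
  \<comment> \<open>Stated for a general pair so that it covers both composites,
    \<open>[f, g]\<close> and \<open>[g, f]\<close>.\<close>
  have unit: "isomorphic_objects (bic_hom X (cmp (src h)) (cmp (src h)))
        (FObj (hcomp X) (FObj \<mu> [h, k])) (hId (\<theta> (cmp (src h))))
      \<longleftrightarrow> is_companion X (FObj (hcomp X) (FObj \<mu> [h, k]))"
    if hk: "h \<in> Obj H" "k \<in> Obj H" "cmp (tgt h) = cmp (src k)" "cmp (tgt k) = cmp (src h)" for h k
  proof -
    obtain h' k' where eq: "FObj \<mu> [h, k] = [h', k']" and i: "h' \<cong> h" "k' \<cong> k" "tgt h' = src k'"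
      using strict_pair[OF pi hk(1-3)] by blast
    have "h' \<in> Obj H" "k' \<in> Obj H"
      using i isomorphic_objects_in_Obj[OF H] by blast+
    note c = hcomposite[OF this i(3)]
    let ?x = "\<theta> (cmp (src h))"
    have x: "?x \<in> Obj V" "cmp ?x = cmp (src h)"
      using \<theta> hk(1) src_tgt by auto
    have comps: "cmp (src (h' \<odot> k')) = cmp (src h)" "cmp (tgt (h' \<odot> k')) = cmp (src h)"
      using c iso_components[OF i(1)] iso_components[OF i(2)] hk by auto
    have "h' \<odot> k' \<in> Obj (bic_hom X (cmp (src h)) (cmp (src h)))"
      and "hId ?x \<in> Obj (bic_hom X (cmp (src h)) (cmp (src h)))"
      using c comps x src_tgt by (auto simp: bic_hom_def Let_def)
    then show ?thesis
      using bic_hom_iso is_companion_iff[OF x(1) c(1)] comps x eq by simp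
  qed
  have "cmp (src f) \<in> Obj (components V)" "cmp (tgt f) \<in> Obj (components V)"
    using src_tgt f by (auto simp: components_def discrete_def)
  then have "is_bicat_equivalence (fundamental_bicat X \<mu> \<epsilon> \<theta>) (cmp (src f)) (cmp (tgt f)) f \<longleftrightarrow>
    (\<exists>g\<in>Obj H. cmp (src g) = cmp (tgt f) \<and> cmp (tgt g) = cmp (src f) \<and>
      isomorphic_objects (bic_hom X (cmp (src f)) (cmp (src f)))
        (FObj (hcomp X) (FObj \<mu> [f, g])) (hId (\<theta> (cmp (src f)))) \<and>
      isomorphic_objects (bic_hom X (cmp (tgt f)) (cmp (tgt f)))
        (FObj (hcomp X) (FObj \<mu> [g, f])) (hId (\<theta> (cmp (tgt f)))))"
    using f by (auto simp: is_bicat_equivalence_def fundamental_bicat_def bic_hom_def Let_def)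
  also have "\<dots> \<longleftrightarrow> (\<exists>g\<in>Obj H. cmp (src g) = cmp (tgt f) \<and> cmp (tgt g) = cmp (src f) \<and>
      is_companion X (FObj (hcomp X) (FObj \<mu> [f, g])) \<and>
      is_companion X (FObj (hcomp X) (FObj \<mu> [g, f])))"
    using unit f by metis
  finally show ?thesis .
qed

text \<open>In a strict replacement \<open>l1, f1, r1\<close> associativity holds on the nose, so
  \<open>r1 = hId (tgt f1) \<odot> r1 \<cong> (l1 \<odot> f1) \<odot> r1 = l1 \<odot> (f1 \<odot>
  r1) \<cong> l1 \<odot> hId (src f1) = l1\<close>.\<close>

lemma left_right_inverse_iso:
  assumes f': "f \<cong> f'" "r \<in> Obj H" "tgt f' = src r" "is_companion X (f' \<odot> r)"
    and f'': "f \<cong> f''" "l \<in> Obj H" "tgt l = src f''" "is_companion X (l \<odot> f'')"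
  shows "r \<cong> l"
proof -
  have f: "f \<in> Obj H"
    using f'(1) isomorphic_objects_in_Obj[OF H] by blast
  obtain l1 f1 r1 where i: "l1 \<cong> l" "f1 \<cong> f" "r1 \<cong> r" and t: "tgt l1 = src f1" "tgt f1 = src r1"
    using strict_triple[OF f''(2) f f'(2)] iso_components[OF f'(1)] iso_components[OF f''(1)]
      f' f'' by metis
  have ob: "l1 \<in> Obj H" "f1 \<in> Obj H" "r1 \<in> Obj H" "f' \<in> Obj H" "f'' \<in> Obj H"
    using i f' f'' isomorphic_objects_in_Obj[OF H] by blast+
  note c = hcomposite[OF ob(1,2) t(1)] hcomposite[OF ob(2,3) t(2)]
    hcomposite[OF ob(4) f'(2,3)] hcomposite[OF f''(2) ob(5) f''(3)]
  have "f1 \<cong> f'" "f1 \<cong> f''"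
    using i f' f'' isos by blast+
  then have fr: "f1 \<odot> r1 \<cong> f' \<odot> r" and lf: "l1 \<odot> f1 \<cong> l \<odot> f''"
    using hcomposite_iso i t f' f'' by blast+
  have "src f1 \<in> Obj V" "tgt f1 \<in> Obj V"
    using ob src_tgt by auto
  \<comment> \<open>The identities are taken at the ends of \<open>f1\<close>, not of
    \<open>f'\<close> or \<open>f''\<close>, so that they compose strictly with \<open>l1\<close>
    and \<open>r1\<close>.\<close>
  then have "f' \<odot> r \<cong> hId (src f1)" "l \<odot> f'' \<cong> hId (tgt f1)"
    using is_companion_iff c f'(4) f''(4) iso_components[OF fr] iso_components[OF lf] t by metis+
  then have 1: "f1 \<odot> r1 \<cong> hId (src f1)" and 2: "l1 \<odot> f1 \<cong> hId (tgt f1)"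
    using fr lf isos by blast+
  have "l1 \<odot> (f1 \<odot> r1) \<cong> l1 \<odot> hId (src f1)"
    using 1 isos(1)[OF ob(1)] t c src_tgt ob by (intro hcomposite_iso) auto
  moreover have "l1 \<odot> hId (src f1) = l1"
    using laws0 ob t unfolding internal_category_laws_def by metis
  moreover have "(l1 \<odot> f1) \<odot> r1 \<cong> hId (tgt f1) \<odot> r1"
    using 2 isos(1)[OF ob(3)] t c src_tgt ob by (intro hcomposite_iso) auto
  moreover have "hId (tgt f1) \<odot> r1 = r1"
    using laws0 ob t unfolding internal_category_laws_def by metis
  moreover have "(l1 \<odot> f1) \<odot> r1 = l1 \<odot> (f1 \<odot> r1)"
    using laws0 ob t by (auto simp: internal_category_laws_def)
  ultimately have "r1 \<cong> l1"
    using isos by metis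
  then show ?thesis
    using i isos by blast
qed

lemma is_companion_cong:
  assumes "h \<cong> k" "is_companion X h"
  shows "is_companion X k"
proof -
  have ob: "h \<in> Obj H" "k \<in> Obj H"
    using assms isomorphic_objects_in_Obj[OF H] by blast+
  then have "h \<cong> hId (src h)"
    using assms is_companion_iff src_tgt by blast
  then have "k \<cong> hId (src h)"
    using assms isos by blast
  then show ?thesis
    using is_companion_iff ob src_tgt iso_components[OF assms(1)] by metis
qed

lemma bic_equivalence_iff_pre_companion:
  assumes ch: "bic_choices X \<mu> \<epsilon> \<theta>" and f: "f \<in> Obj H"
  shows "is_bicat_equivalence (fundamental_bicat X \<mu> \<epsilon> \<theta>) (cmp (src f)) (cmp (tgt f)) f
    \<longleftrightarrow> pre_companion X f"
proof -
  note pi = ch[unfolded bic_choices_def, THEN conjunct1]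
  show ?thesis
    unfolding bic_equivalence_iff[OF assms]
  proof
    assume "\<exists>g\<in>Obj H. cmp (src g) = cmp (tgt f) \<and> cmp (tgt g) = cmp (src f) \<and>
      is_companion X (FObj (hcomp X) (FObj \<mu> [f, g])) \<and>
      is_companion X (FObj (hcomp X) (FObj \<mu> [g, f]))"
    then obtain g where g: "g \<in> Obj H" "cmp (tgt f) = cmp (src g)" "cmp (tgt g) = cmp (src f)"
      "is_companion X (FObj (hcomp X) (FObj \<mu> [f, g]))"
      "is_companion X (FObj (hcomp X) (FObj \<mu> [g, f]))"
      by metis
    obtain f1 g1 where 1: "FObj \<mu> [f, g] = [f1, g1]" "f1 \<cong> f" "g1 \<cong> g" "tgt f1 = src g1"
      using strict_pair[OF pi f g(1,2)] by blast
    obtain g2 f2 where 2: "FObj \<mu> [g, f] = [g2, f2]" "g2 \<cong> g" "f2 \<cong> f" "tgt g2 = src f2"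
      using strict_pair[OF pi g(1) f g(3)] by blast
    \<comment> \<open>The two composites may involve different strict replacements of
      \<open>f\<close>: \<open>f1\<close> witnesses the left condition and \<open>f2\<close> the
      right one.\<close>
    have "f1 \<in> Obj H" "g1 \<in> Obj H" "f2 \<in> Obj H" "g2 \<in> Obj H" "f \<cong> f1" "f \<cong> f2"
      using 1 2 isomorphic_objects_in_Obj[OF H] isos by blast+
    then show "pre_companion X f"
      unfolding pre_companion_def left_pre_companion_def right_pre_companion_def
      using 1 2 g by metis
  next
    assume "pre_companion X f"
    then obtain f' r f'' l
      where f': "f \<cong> f'" "r \<in> Obj H" "tgt f' = src r" "is_companion X (f' \<odot> r)"
        and f'': "f \<cong> f''" "l \<in> Obj H" "tgt l = src f''" "is_companion X (l \<odot> f'')"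
      unfolding pre_companion_def left_pre_companion_def right_pre_companion_def by metis
    have rl: "r \<cong> l"
      using left_right_inverse_iso f' f'' by blast
    have ob: "f' \<in> Obj H"
      using f' isomorphic_objects_in_Obj[OF H] by blast
    \<comment> \<open>The codomain of \<open>r\<close> is unconstrained by the left condition; that
      it lies in the component of the source of \<open>f\<close> comes from \<open>l\<close> through
      \<open>r \<cong> l\<close>. Only then is \<open>r\<close> a 1-cell in the reverse
      direction.\<close>
    have r: "cmp (tgt f) = cmp (src r)" "cmp (tgt r) = cmp (src f)"
      using iso_components[OF f'(1)] iso_components[OF f''(1)] iso_components[OF rl] f' f''
      by auto
    obtain f1 r1 where 1: "FObj \<mu> [f, r] = [f1, r1]" "f1 \<cong> f" "r1 \<cong> r" "tgt f1 = src r1"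
      using strict_pair[OF pi f f'(2) r(1)] by blast
    obtain r2 f2 where 2: "FObj \<mu> [r, f] = [r2, f2]" "r2 \<cong> r" "f2 \<cong> f" "tgt r2 = src f2"
      using strict_pair[OF pi f'(2) f r(2)] by blast
    \<comment> \<open>The chosen composite of \<open>r\<close> and \<open>f\<close> is compared with
      \<open>l \<odot> f''\<close>, again using \<open>r \<cong> l\<close>.\<close>
    have "f' \<cong> f1" "r \<cong> r1" "f'' \<cong> f2" "l \<cong> r2"
      using 1 2 f' f'' rl isos by blast+
    then have "f' \<odot> r \<cong> f1 \<odot> r1" "l \<odot> f'' \<cong> r2 \<odot> f2"
      using hcomposite_iso f' f'' 1 2 by blast+
    then have "is_companion X (f1 \<odot> r1)" "is_companion X (r2 \<odot> f2)"
      using is_companion_cong f' f'' by blast+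
    then show "\<exists>g\<in>Obj H. cmp (src g) = cmp (tgt f) \<and> cmp (tgt g) = cmp (src f) \<and>
      is_companion X (FObj (hcomp X) (FObj \<mu> [f, g])) \<and>
      is_companion X (FObj (hcomp X) (FObj \<mu> [g, f]))"
      using f'(2) r 1(1) 2(1) by metis
  qed
qed

end

theorem proposition6p14:
  fixes X :: "('o, 'v, 'h, 'c) double_cat"
    and \<mu> :: "('h list, 'c list, 'h list, 'c list) cfunctor"
    and \<epsilon> :: "'h list \<Rightarrow> 'c list"
    and \<theta> :: "'o set \<Rightarrow> 'o"
    and A B :: 'o
    and f :: 'h
  assumes "weakly_globular X"
    and "bic_choices X \<mu> \<epsilon> \<theta>"
    and "f \<in> Obj (HCat X)" and "FObj (hdom X) f = A" and "FObj (hcod X) f = B"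
  shows "is_bicat_equivalence (fundamental_bicat X \<mu> \<epsilon> \<theta>)
           (component (VCat X) A) (component (VCat X) B) f
         \<longleftrightarrow> pre_companion X f"
proof -
  interpret weakly_globular_double_category X
    using assms(1) by unfold_locales
  show ?thesis
    using bic_equivalence_iff_pre_companion[OF assms(2,3)] assms(4,5) by simp
qed

end
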